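(* Let $F:\mathbb{R}^2\times\mathbb{R}\to\mathbb{R}$, $(x,y,\alpha)\mapsto F(x,y,\alpha)$, be of class $\mathcal{C}^1$, and let $f:U\to\mathbb{R}$ be of class $\mathcal{C}^1$ on an open set $U\subset\mathbb{R}^2$ with $F(x,f(x,\alpha),\alpha)=0$ for all $(x,\alpha)\in U$. Fix $\alpha$ and let $x_0$ be a periodic point of $f(\cdot,\alpha)$ of period $p\ge 1$, with orbit $x_{i+1}=f(x_i,\alpha)$, $(x_i,\alpha)\in U$ for $0\le i\le p-1$, and $x_p=x_0$. Assume $F_y(x_i,x_{i+1},\alpha)\ne 0$ for $0\le i\le p-1$ and that $x_0$ satisfies the bifurcation equation $\partial_x f^p(x_0,\alpha)=\pm1$. Then $$\partial_\alpha f^{p}(x_0,\alpha)=(-1)^{p}\sum_{j=0}^{p-1}\frac{(-1)^jF_\alpha(x_j,x_{j+1},\alpha)}{F_y(x_j,x_{j+1},\alpha)}\prod_{i=j+1}^{p-1}\frac{F_x(x_i,x_{i+1},\alpha)}{F_y(x_i,x_{i+1},\alpha)} ,$$ where the empty product equals $1$.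
   Context: The equation $F(x_n,x_{n+1},\alpha)=0$ defines implicitly a one-dimensional discrete dynamical system $x_{n+1}=f(x_n,\alpha)$, where $\alpha$ is a real parameter. $f^{i}$ denotes the $i$-fold composition of $f$ in the dynamic variable with the parameter fixed: $f^{0}(x,\alpha)=x$, $f^{i+1}(x,\alpha)=f(f^{i}(x,\alpha),\alpha)$. $F_x$, $F_y$, $F_\alpha$ denote the partial derivatives of $F$ with respect to its first, second and third arguments. $\partial_x f^p$ and $\partial_\alpha f^{p}$ are the partial derivatives of the function $(x,\alpha)\mapsto f^{p}(x,\alpha)$. *)

theory Defs
  imports "HOL-Analysis.Analysis"
begin

text \<open>The derivative is taken at the full neighbourhood filter and is continuous in operator
  norm, so this is class \<open>C\<^sup>1\<close> for open \<open>S\<close>, the only case in which it is used.\<close>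

definition C1_on ::
    "('a::real_normed_vector \<Rightarrow> 'b::real_normed_vector) \<Rightarrow> 'a set \<Rightarrow> bool"
  where "C1_on g S \<longleftrightarrow>
    (\<exists>g' :: 'a \<Rightarrow> 'a \<Rightarrow>\<^sub>L 'b.
      (\<forall>z\<in>S. (g has_derivative blinfun_apply (g' z)) (at z)) \<and> continuous_on S g')"

definition F_x :: "(real \<times> real \<times> real \<Rightarrow> real) \<Rightarrow> real \<Rightarrow> real \<Rightarrow> real \<Rightarrow> real"
  where "F_x F x y \<alpha> = deriv (\<lambda>t. F (t, y, \<alpha>)) x"

definition F_y :: "(real \<times> real \<times> real \<Rightarrow> real) \<Rightarrow> real \<Rightarrow> real \<Rightarrow> real \<Rightarrow> real"
  where "F_y F x y \<alpha> = deriv (\<lambda>t. F (x, t, \<alpha>)) y"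

definition F_\<alpha> :: "(real \<times> real \<times> real \<Rightarrow> real) \<Rightarrow> real \<Rightarrow> real \<Rightarrow> real \<Rightarrow> real"
  where "F_\<alpha> F x y \<alpha> = deriv (\<lambda>t. F (x, y, t)) \<alpha>"

text \<open>A map \<open>f : U \<rightarrow> \<real>\<close> on an open set \<open>U\<close> is represented by a total function whose values
  outside \<open>U\<close> are arbitrary. If the first \<open>i\<close> points \<open>(x, \<alpha>), (f (x, \<alpha>), \<alpha>), \<dots>\<close> of an orbit lie
  in \<open>U\<close> and \<open>f\<close> is continuous on \<open>U\<close>, the same holds for all nearby \<open>(x, \<alpha>)\<close>, so that the
  derivatives of \<open>iterate f i\<close> there depend on the restriction of \<open>f\<close> to \<open>U\<close> only.\<close>

definition iterate :: "(real \<times> real \<Rightarrow> real) \<Rightarrow> nat \<Rightarrow> real \<times> real \<Rightarrow> real"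
  where "iterate f i = (\<lambda>(x, \<alpha>). ((\<lambda>z. f (z, \<alpha>)) ^^ i) x)"

end

theory Submission
  imports Defs
begin

text \<open>Differentiating the identity \<open>F (z, f (z, a), a) = 0\<close> at a point of \<open>U\<close> where \<open>F_y \<noteq> 0\<close> gives
  the total derivative of \<open>f\<close> there: it is \<open>(u, v) \<mapsto> - a u - b v\<close> with \<open>a = F_x / F_y\<close> and
  \<open>b = F\<^sub>\<alpha> / F_y\<close> (\<open>has_derivative_of_implicit\<close>). By the chain rule the parameter derivatives \<open>D n\<close> of
  \<open>f\<^sup>n\<close> along the orbit therefore satisfy the inhomogeneous linear recurrence
  \<open>D (n + 1) = - a\<^sub>n D n - b\<^sub>n\<close> with \<open>D 0 = 0\<close>: the parameter enters the step from \<open>x\<^sub>n\<close> to \<open>x\<^sub>n\<^sub>+\<^sub>1\<close>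
  through the previous iterate and directly. Variation of constants solves the recurrence: the
  contribution \<open>- b\<^sub>j\<close> of step \<open>j\<close> is multiplied by \<open>- a\<^sub>i\<close> at every later step \<open>i\<close>, so that up to
  time \<open>n\<close> it acquires the sign \<open>(-1)\<^bsup>n - j\<^esup> = (-1)\<^sup>n (-1)\<^sup>j\<close>, which is the sum in the theorem.\<close>

lemma C1_on_imp_differentiable:
  assumes "C1_on g S" and "z \<in> S"
  shows "g differentiable (at z)"
  using assms unfolding C1_on_def differentiable_def by blast

text \<open>The partial derivatives are defined by \<open>deriv\<close>; at a point of differentiability they are the
  coefficients of the total derivative, because each coordinate line is an affine curve.\<close>

lemma has_derivative_partials:
  assumes "F differentiable (at (x, y, \<alpha>))"
  shows "(F has_derivative (\<lambda>(u, w, v). F_x F x y \<alpha> * u + F_y F x y \<alpha> * w + F_\<alpha> F x y \<alpha> * v))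
    (at (x, y, \<alpha>))"
proof -
  obtain F' where F': "(F has_derivative F') (at (x, y, \<alpha>))"
    using assms unfolding differentiable_def by blast
  have lin: "linear F'"
    using F' by (rule has_derivative_linear)
  have scale: "F' (u, 0, 0) = F' (1, 0, 0) * u" "F' (0, u, 0) = F' (0, 1, 0) * u"
    "F' (0, 0, u) = F' (0, 0, 1) * u" for u
    using linear_scale[OF lin, of u "(1, 0, 0)"] linear_scale[OF lin, of u "(0, 1, 0)"]
      linear_scale[OF lin, of u "(0, 0, 1)"] by (simp_all add: mult.commute)
  then have line: "(\<lambda>u. F' (u, 0, 0)) = (*) (F' (1, 0, 0))"
    "(\<lambda>u. F' (0, u, 0)) = (*) (F' (0, 1, 0))" "(\<lambda>u. F' (0, 0, u)) = (*) (F' (0, 0, 1))"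
    by blast+
  have "((\<lambda>t. F (t, y, \<alpha>)) has_derivative (\<lambda>u. F' (u, 0, 0))) (at x)"
    by (rule has_derivative_compose[where g = F and g' = F'
          and f = "\<lambda>t. (t, y, \<alpha>)" and f' = "\<lambda>u. (u, 0, 0)"])
      (intro has_derivative_Pair has_derivative_ident has_derivative_const F')+
  then have x: "F_x F x y \<alpha> = F' (1, 0, 0)"
    unfolding F_x_def by (intro DERIV_imp_deriv) (simp only: has_field_derivative_def line(1))
  have "((\<lambda>t. F (x, t, \<alpha>)) has_derivative (\<lambda>u. F' (0, u, 0))) (at y)"
    by (rule has_derivative_compose[where g = F and g' = F'
          and f = "\<lambda>t. (x, t, \<alpha>)" and f' = "\<lambda>u. (0, u, 0)"])
      (intro has_derivative_Pair has_derivative_ident has_derivative_const F')+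
  then have y: "F_y F x y \<alpha> = F' (0, 1, 0)"
    unfolding F_y_def by (intro DERIV_imp_deriv) (simp only: has_field_derivative_def line(2))
  have "((\<lambda>t. F (x, y, t)) has_derivative (\<lambda>u. F' (0, 0, u))) (at \<alpha>)"
    by (rule has_derivative_compose[where g = F and g' = F'
          and f = "\<lambda>t. (x, y, t)" and f' = "\<lambda>u. (0, 0, u)"])
      (intro has_derivative_Pair has_derivative_ident has_derivative_const F')+
  then have a: "F_\<alpha> F x y \<alpha> = F' (0, 0, 1)"
    unfolding F_\<alpha>_def by (intro DERIV_imp_deriv) (simp only: has_field_derivative_def line(3))
  have "F' (u, w, v) = F_x F x y \<alpha> * u + F_y F x y \<alpha> * w + F_\<alpha> F x y \<alpha> * v" for u w v
  proof -
    have "F' (u, w, v) = F' ((u, 0, 0) + ((0, w, 0) + (0, 0, v)))"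
      by simp
    also have "\<dots> = F' (u, 0, 0) + (F' (0, w, 0) + F' (0, 0, v))"
      by (simp only: linear_add[OF lin])
    finally show ?thesis
      by (simp add: scale[of u] scale[of w] scale[of v] x y a)
  qed
  then have "F' = (\<lambda>(u, w, v). F_x F x y \<alpha> * u + F_y F x y \<alpha> * w + F_\<alpha> F x y \<alpha> * v)"
    by (simp add: fun_eq_iff)
  then show ?thesis
    using F' by simp
qed

text \<open>The map \<open>(z, a) \<mapsto> F (z, f (z, a), a)\<close> vanishes near the point, so its derivative, computed by
  the chain rule, is zero; this is a linear equation for the derivative of \<open>f\<close>, solvable because
  \<open>F_y \<noteq> 0\<close>.\<close>

lemma has_derivative_of_implicit:
  assumes F: "F differentiable (at (x, f (x, \<alpha>), \<alpha>))"
    and f: "f differentiable (at (x, \<alpha>))"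
    and U: "open U" "(x, \<alpha>) \<in> U"
    and implicit: "\<And>z a. (z, a) \<in> U \<Longrightarrow> F (z, f (z, a), a) = 0"
    and nz: "F_y F x (f (x, \<alpha>)) \<alpha> \<noteq> 0"
  shows "(f has_derivative
      (\<lambda>(u, v). - (F_x F x (f (x, \<alpha>)) \<alpha> / F_y F x (f (x, \<alpha>)) \<alpha>) * u
        - F_\<alpha> F x (f (x, \<alpha>)) \<alpha> / F_y F x (f (x, \<alpha>)) \<alpha> * v)) (at (x, \<alpha>))"
proof -
  define y where "y = f (x, \<alpha>)"
  obtain f' where f': "(f has_derivative f') (at (x, \<alpha>))"
    using f unfolding differentiable_def by blast
  have "((\<lambda>q. (fst q, f q, snd q)) has_derivative (\<lambda>h. (fst h, f' h, snd h))) (at (x, \<alpha>))"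
    by (auto intro!: derivative_eq_intros f')
  then have chain: "((\<lambda>q. F (fst q, f q, snd q)) has_derivative
      (\<lambda>h. F_x F x y \<alpha> * fst h + F_y F x y \<alpha> * f' h + F_\<alpha> F x y \<alpha> * snd h)) (at (x, \<alpha>))"
    using has_derivative_compose[where g = F and f = "\<lambda>q. (fst q, f q, snd q)"
          and f' = "\<lambda>h. (fst h, f' h, snd h)" and x = "(x, \<alpha>)" and s = UNIV
        and g' = "\<lambda>(u, w, v). F_x F x y \<alpha> * u + F_y F x y \<alpha> * w + F_\<alpha> F x y \<alpha> * v"]
      has_derivative_partials[OF F] by (simp add: y_def)
  have "((\<lambda>q. F (fst q, f q, snd q)) has_derivative (\<lambda>_. 0)) (at (x, \<alpha>))"
    by (rule has_derivative_transform_within_open[where f = "\<lambda>_. 0", OF _ U])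
      (auto simp: implicit)
  then have "(\<lambda>h. F_x F x y \<alpha> * fst h + F_y F x y \<alpha> * f' h + F_\<alpha> F x y \<alpha> * snd h) = (\<lambda>_. 0)"
    using chain has_derivative_unique by blast
  then have zero: "F_x F x y \<alpha> * u + F_y F x y \<alpha> * f' (u, v) + F_\<alpha> F x y \<alpha> * v = 0" for u v
    by (auto dest: fun_cong[where x = "(u, v)"])
  have "f' (u, v) = - (F_x F x y \<alpha> / F_y F x y \<alpha>) * u - F_\<alpha> F x y \<alpha> / F_y F x y \<alpha> * v" for u v
    using zero[of u v] nz unfolding y_def[symmetric] by (simp add: field_simps)
  then have "f' = (\<lambda>(u, v). - (F_x F x y \<alpha> / F_y F x y \<alpha>) * u - F_\<alpha> F x y \<alpha> / F_y F x y \<alpha> * v)"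
    by (simp add: fun_eq_iff)
  then show ?thesis
    using f' unfolding y_def by simp
qed

lemma iterate_0: "iterate f 0 (z, a) = z"
  by (simp add: iterate_def)

lemma iterate_Suc: "iterate f (Suc n) (z, a) = f (iterate f n (z, a), a)"
  by (simp add: iterate_def)

lemma iterate_orbit:
  assumes "\<And>i. i < n \<Longrightarrow> x (Suc i) = f (x i, \<alpha>)"
  shows "iterate f n (x 0, \<alpha>) = x n"
  using assms by (induction n) (simp_all add: iterate_0 iterate_Suc)

text \<open>One step of the solution by variation of constants: the earlier terms gain the factor \<open>- a n\<close>
  and the new term \<open>j = n\<close> has an empty product and sign \<open>(-1)\<^bsup>2 n + 1\<^esup>\<close>.\<close>

lemma alternating_sum_prod_Suc:
  fixes a b :: "nat \<Rightarrow> 'a::comm_ring_1"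
  shows "(-1) ^ Suc n * (\<Sum>j<Suc n. (-1) ^ j * b j * (\<Prod>i=j+1..<Suc n. a i))
    = - a n * ((-1) ^ n * (\<Sum>j<n. (-1) ^ j * b j * (\<Prod>i=j+1..<n. a i))) - b n"
proof -
  have "(\<Sum>j<n. (-1) ^ j * b j * (\<Prod>i=j+1..<Suc n. a i))
      = a n * (\<Sum>j<n. (-1) ^ j * b j * (\<Prod>i=j+1..<n. a i))"
    unfolding sum_distrib_left by (rule sum.cong) (simp_all add: mult_ac)
  moreover have "(-1) ^ n * ((-1) ^ n * b n) = b n"
    by (simp add: mult.assoc[symmetric] power_mult_distrib[symmetric])
  ultimately show ?thesis
    by (simp add: algebra_simps)
qed

lemma iterate_has_parameter_derivative:
  fixes x a b :: "nat \<Rightarrow> real"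
  assumes "\<And>i. i < n \<Longrightarrow> x (Suc i) = f (x i, \<alpha>)"
    and "\<And>i. i < n \<Longrightarrow> (f has_derivative (\<lambda>(u, v). - a i * u - b i * v)) (at (x i, \<alpha>))"
  shows "((\<lambda>t. iterate f n (x 0, t)) has_real_derivative
      (-1) ^ n * (\<Sum>j<n. (-1) ^ j * b j * (\<Prod>i=j+1..<n. a i))) (at \<alpha>)"
  using assms
proof (induction n)
  case 0
  then show ?case
    by (simp add: iterate_0)
next
  case (Suc n)
  define D where "D = (-1) ^ n * (\<Sum>j<n. (-1) ^ j * b j * (\<Prod>i=j+1..<n. a i))"
  have "((\<lambda>t. iterate f n (x 0, t)) has_real_derivative D) (at \<alpha>)"
    using Suc unfolding D_def by simp
  then have "((\<lambda>t. (iterate f n (x 0, t), t)) has_derivative (\<lambda>v. (D * v, v))) (at \<alpha>)"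
    unfolding has_field_derivative_def by (intro has_derivative_Pair has_derivative_ident)
  moreover have "(f has_derivative (\<lambda>(u, v). - a n * u - b n * v)) (at (iterate f n (x 0, \<alpha>), \<alpha>))"
    using Suc.prems iterate_orbit[of n x f \<alpha>] by simp
  ultimately have "((\<lambda>t. f (iterate f n (x 0, t), t)) has_derivative
      (\<lambda>v. - a n * (D * v) - b n * v)) (at \<alpha>)"
    by (auto dest: has_derivative_compose[where g = f])
  then have "((\<lambda>t. iterate f (Suc n) (x 0, t)) has_real_derivative - a n * D - b n) (at \<alpha>)"
    unfolding has_field_derivative_def iterate_Suc
    by (rule has_derivative_eq_rhs) (simp add: fun_eq_iff algebra_simps)
  then show ?case
    unfolding D_def by (simp only: alternating_sum_prod_Suc)
qed

theorem corollary3p4: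
  fixes F :: "real \<times> real \<times> real \<Rightarrow> real"
    and f :: "real \<times> real \<Rightarrow> real"
    and U :: "(real \<times> real) set"
    and \<alpha> :: real and x :: "nat \<Rightarrow> real" and p :: nat
  assumes F_C1: "C1_on F UNIV"
    and U_open: "open U"
    and f_C1: "C1_on f U"
    and implicit: "\<And>z a. (z, a) \<in> U \<Longrightarrow> F (z, f (z, a), a) = 0"
    and p_pos: "p \<ge> 1"
    and orbit_in: "\<And>i. i < p \<Longrightarrow> (x i, \<alpha>) \<in> U"
    and orbit: "\<And>i. i < p \<Longrightarrow> x (Suc i) = f (x i, \<alpha>)"
    and periodic: "x p = x 0"
    and F_y_nonzero: "\<And>i. i < p \<Longrightarrow> F_y F (x i) (x (Suc i)) \<alpha> \<noteq> 0"
    and bifurcation: "deriv (\<lambda>z. iterate f p (z, \<alpha>)) (x 0) \<in> {1, -1}"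
  shows "((\<lambda>a. iterate f p (x 0, a)) has_real_derivative
      (-1) ^ p * (\<Sum>j<p. (-1) ^ j * F_\<alpha> F (x j) (x (Suc j)) \<alpha> / F_y F (x j) (x (Suc j)) \<alpha>
        * (\<Prod>i=j+1..<p. F_x F (x i) (x (Suc i)) \<alpha> / F_y F (x i) (x (Suc i)) \<alpha>))) (at \<alpha>)"
proof -
  have "(f has_derivative (\<lambda>(u, v). - (F_x F (x i) (x (Suc i)) \<alpha> / F_y F (x i) (x (Suc i)) \<alpha>) * u
      - F_\<alpha> F (x i) (x (Suc i)) \<alpha> / F_y F (x i) (x (Suc i)) \<alpha> * v)) (at (x i, \<alpha>))"
    if "i < p" for i
    using has_derivative_of_implicit[of F "x i" f \<alpha> U] C1_on_imp_differentiable[OF F_C1]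
      C1_on_imp_differentiable[OF f_C1 orbit_in] U_open orbit_in implicit F_y_nonzero orbit that
    by auto
  with orbit show ?thesis
    using iterate_has_parameter_derivative[where n = p and x = x and f = f and \<alpha> = \<alpha>
        and a = "\<lambda>i. F_x F (x i) (x (Suc i)) \<alpha> / F_y F (x i) (x (Suc i)) \<alpha>"
        and b = "\<lambda>i. F_\<alpha> F (x i) (x (Suc i)) \<alpha> / F_y F (x i) (x (Suc i)) \<alpha>"]
    by simp
qed

end
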